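(* Let $\mathcal{A}$ be a $C^\star$-algebra, let $F_0,F_1,\dots,F_m\in\mathcal{A}$ be selfadjoint, let $f_1,\dots,f_m\in\mathbb{R}$, and let $\mathcal{F}=\operatorname{span}\{F_0,\dots,F_m\}$. Let $\gamma=\{\gamma_1,\dots,\gamma_n\}\subset\mathcal{A}$ be a finite sequence such that $\mathcal{F}\subset Q_n=\operatorname{span}\{\gamma_i\gamma_j^\star : 1\le i,j\le n\}$. Then the value of the $C^\star$-SDP $$\inf\{\omega(F_0) : \omega\in\mathcal{P}_+(\mathcal{A})^\star,\ \omega(F_i)\le f_i \ \text{ for all } i\in\{1,\dots,m\}\}$$ is bounded from below by the value of $$\inf\{\omega(F_0) : \omega\in(\Sigma_2^{(n)})^\star|_{\mathcal{F}},\ \omega(F_i)\le f_i \ \text{ for all } i\in\{1,\dots,m\}\}.$$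
   Context: $\mathcal{P}_+(\mathcal{A})=\{XX^\star : X\in\mathcal{A}\}$ is the cone of positive elements of $\mathcal{A}$, and $\mathcal{P}_+(\mathcal{A})^\star$ is the set of all linear functionals $\omega:\mathcal{A}\to\mathbb{C}$ with $\omega(XX^\star)\ge 0$ for all $X\in\mathcal{A}$. For the sequence $\gamma$, put $V_n=\operatorname{span}\{\gamma_1,\dots,\gamma_n\}$ (complex span), $Q_n=\operatorname{span}\{\gamma_i\gamma_j^\star : 1\le i,j\le n\}$, and $\Sigma_2^{(n)}=\operatorname{conv}\{vv^\star : v\in V_n\}\subset Q_n$ (convex hull). The dual cone $(\Sigma_2^{(n)})^\star$ is the set of linear functionals $\omega:Q_n\to\mathbb{C}$ with $\omega(s)\ge 0$ for all $s\in\Sigma_2^{(n)}$, and $(\Sigma_2^{(n)})^\star|_{\mathcal{F}}$ is the set of restrictions of such functionals to $\mathcal{F}$. Infima are taken in the extended reals, with the infimum of the empty set equal to $+\infty$. *)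

theory Defs
  imports "HOL-Analysis.Analysis" "HOL-Library.Complex_Order"
begin

text \<open>
  The library has no complex Banach algebras and no \<open>C\<^sup>*\<close>-algebras. As in the library class
  \<^class>\<open>real_normed_algebra\<close> underlying it, the class below does not require a unit.
\<close>

class c_star_algebra = real_normed_algebra + complete_space +
  fixes scaleC :: "complex \<Rightarrow> 'a \<Rightarrow> 'a" (infixr \<open>*\<^sub>C\<close> 75)
    and adj :: "'a \<Rightarrow> 'a" (\<open>(_\<^sup>\<star>)\<close> [1000] 999)
  assumes scaleC_add_right: "a *\<^sub>C (x + y) = a *\<^sub>C x + a *\<^sub>C y"
    and scaleC_add_left: "(a + b) *\<^sub>C x = a *\<^sub>C x + b *\<^sub>C x"
    and scaleC_scaleC: "a *\<^sub>C b *\<^sub>C x = (a * b) *\<^sub>C x"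
    and scaleR_scaleC: "scaleR r x = complex_of_real r *\<^sub>C x"
    and norm_scaleC: "norm (a *\<^sub>C x) = cmod a * norm x"
    and mult_scaleC_left: "(a *\<^sub>C x) * y = a *\<^sub>C (x * y)"
    and mult_scaleC_right: "x * (a *\<^sub>C y) = a *\<^sub>C (x * y)"
    and adj_adj: "(x\<^sup>\<star>)\<^sup>\<star> = x"
    and adj_add: "(x + y)\<^sup>\<star> = x\<^sup>\<star> + y\<^sup>\<star>"
    and adj_scaleC: "(a *\<^sub>C x)\<^sup>\<star> = cnj a *\<^sub>C x\<^sup>\<star>"
    and adj_mult: "(x * y)\<^sup>\<star> = y\<^sup>\<star> * x\<^sup>\<star>"
    and C_star_identity: "norm (x\<^sup>\<star> * x) = (norm x)\<^sup>2"

interpretation complex_vec: vector_space "scaleC :: complex \<Rightarrow> 'a \<Rightarrow> 'a::c_star_algebra"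
proof
  show "1 *\<^sub>C x = x" for x :: 'a
    using scaleR_scaleC[of 1 x] by simp
qed (simp_all add: scaleC_add_right scaleC_add_left scaleC_scaleC)

abbreviation cspan :: "'a::c_star_algebra set \<Rightarrow> 'a set" where
  "cspan \<equiv> module.span scaleC"

instantiation complex :: c_star_algebra
begin

definition scaleC_complex :: "complex \<Rightarrow> complex \<Rightarrow> complex" where
  "scaleC_complex = (*)"

definition adj_complex :: "complex \<Rightarrow> complex" where
  "adj_complex = cnj"

instance
  by standard
    (simp_all add: scaleC_complex_def adj_complex_def algebra_simps scaleR_conv_of_real
      norm_mult power2_eq_square)

end

definition selfadjoint :: "'a::c_star_algebra \<Rightarrow> bool" where
  "selfadjoint x \<longleftrightarrow> x\<^sup>\<star> = x"

definition positive_cone :: "'a::c_star_algebra set" where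
  "positive_cone = {x * x\<^sup>\<star> | x. True}"

text \<open>
  The order on \<^typ>\<open>complex\<close> is that of \<^theory>\<open>HOL-Library.Complex_Order\<close>: \<open>0 \<le> z\<close> means that \<open>z\<close>
  is real and nonnegative. Functionals are not required to be bounded.
\<close>

definition positive_dual :: "('a::c_star_algebra \<Rightarrow> complex) set" where
  "positive_dual = {\<omega>. Vector_Spaces.linear scaleC (*) \<omega> \<and> (\<forall>p\<in>positive_cone. 0 \<le> \<omega> p)}"

definition V_space :: "(nat \<Rightarrow> 'a::c_star_algebra) \<Rightarrow> nat \<Rightarrow> 'a set" where
  "V_space \<gamma> n = cspan (\<gamma> ` {1..n})"

definition Q_space :: "(nat \<Rightarrow> 'a::c_star_algebra) \<Rightarrow> nat \<Rightarrow> 'a set" where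
  "Q_space \<gamma> n = cspan {\<gamma> i * (\<gamma> j)\<^sup>\<star> | i j. i \<in> {1..n} \<and> j \<in> {1..n}}"

definition Sigma2 :: "(nat \<Rightarrow> 'a::c_star_algebra) \<Rightarrow> nat \<Rightarrow> 'a set" where
  "Sigma2 \<gamma> n = convex hull {v * v\<^sup>\<star> | v. v \<in> V_space \<gamma> n}"

text \<open>
  A functional on a proper subspace \<open>S\<close> is a function that is linear on \<open>S\<close> and, so that it is
  determined by its values on \<open>S\<close>, takes the value \<^const>\<open>undefined\<close> outside \<open>S\<close>.
\<close>

definition linear_functionals_on :: "'a::c_star_algebra set \<Rightarrow> ('a \<Rightarrow> complex) set" where
  "linear_functionals_on S = {\<omega> \<in> extensional S.
     (\<forall>x\<in>S. \<forall>y\<in>S. \<omega> (x + y) = \<omega> x + \<omega> y) \<and> (\<forall>c. \<forall>x\<in>S. \<omega> (c *\<^sub>C x) = c * \<omega> x)}"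

definition Sigma2_dual :: "(nat \<Rightarrow> 'a::c_star_algebra) \<Rightarrow> nat \<Rightarrow> ('a \<Rightarrow> complex) set" where
  "Sigma2_dual \<gamma> n =
     {\<omega> \<in> linear_functionals_on (Q_space \<gamma> n). \<forall>s\<in>Sigma2 \<gamma> n. 0 \<le> \<omega> s}"

definition restrictions :: "('a \<Rightarrow> complex) set \<Rightarrow> 'a set \<Rightarrow> ('a \<Rightarrow> complex) set" where
  "restrictions W S = (\<lambda>\<omega>. restrict \<omega> S) ` W"

text \<open>
  The values of a program are taken as \<^term>\<open>Re (\<omega> F)\<close>. For \<open>\<omega>\<close> in \<^term>\<open>Sigma2_dual \<gamma> n\<close> and
  selfadjoint \<open>F\<close> in \<^term>\<open>Q_space \<gamma> n\<close>, the number \<^term>\<open>\<omega> F\<close> is real, so nothing is lost; and the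
  same holds for \<open>\<omega>\<close> in \<^const>\<open>positive_dual\<close>, whose restriction to \<^term>\<open>Q_space \<gamma> n\<close> lies in \<^term>\<open>Sigma2_dual \<gamma> n\<close>.
\<close>

lemma real_if_polarized:
  fixes a b :: complex
  assumes "a + b \<in> \<real>" "\<i> * b - \<i> * a \<in> \<real>"
  shows "b = cnj a"
  using assms by (auto simp: complex_is_Real_iff complex_eq_iff)

lemma Sigma2_generator_in_Q:
  assumes "v \<in> V_space \<gamma> n" "w \<in> V_space \<gamma> n"
  shows "v * w\<^sup>\<star> \<in> Q_space \<gamma> n"
proof -
  have adj0: "(0::'a)\<^sup>\<star> = 0"
    using adj_scaleC[of 0 "0::'a"] by simp
  have *: "\<gamma> i * w\<^sup>\<star> \<in> Q_space \<gamma> n" if i: "i \<in> {1..n}" for i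
    using assms(2) unfolding V_space_def
  proof (induction rule: complex_vec.span_induct_alt)
    case base
    show ?case by (simp add: adj0 Q_space_def complex_vec.span_zero)
  next
    case (step c x y)
    then obtain j where "j \<in> {1..n}" "x = \<gamma> j" by auto
    then have "\<gamma> i * x\<^sup>\<star> \<in> Q_space \<gamma> n"
      using i unfolding Q_space_def by (blast intro: complex_vec.span_base)
    then show ?case
      using step.IH unfolding Q_space_def
      by (simp add: adj_add adj_scaleC distrib_left mult_scaleC_right
          complex_vec.span_add complex_vec.span_scale)
  qed
  show ?thesis
    using assms(1) unfolding V_space_def
  proof (induction rule: complex_vec.span_induct_alt)
    case base
    show ?case by (simp add: Q_space_def complex_vec.span_zero)
  next
    case (step c x y)
    then have "x * w\<^sup>\<star> \<in> Q_space \<gamma> n" using * by auto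
    then show ?case
      using step.IH unfolding Q_space_def
      by (simp add: distrib_right mult_scaleC_left complex_vec.span_add complex_vec.span_scale)
  qed
qed

lemma Sigma2_dual_adj:
  assumes \<omega>: "\<omega> \<in> Sigma2_dual \<gamma> n" and x: "x \<in> Q_space \<gamma> n"
  shows "x\<^sup>\<star> \<in> Q_space \<gamma> n \<and> \<omega> (x\<^sup>\<star>) = cnj (\<omega> x)"
proof -
  let ?Q = "Q_space \<gamma> n" and ?V = "V_space \<gamma> n"
  have add: "\<omega> (x + y) = \<omega> x + \<omega> y" if "x \<in> ?Q" "y \<in> ?Q" for x y
    using \<omega> that by (auto simp: Sigma2_dual_def linear_functionals_on_def)
  have scale: "\<omega> (c *\<^sub>C x) = c * \<omega> x" if "x \<in> ?Q" for c x
    using \<omega> that by (auto simp: Sigma2_dual_def linear_functionals_on_def)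
  have Qadd: "x + y \<in> ?Q" if "x \<in> ?Q" "y \<in> ?Q" for x y
    using that by (simp add: Q_space_def complex_vec.span_add)
  have Qscale: "c *\<^sub>C x \<in> ?Q" if "x \<in> ?Q" for c x
    using that by (simp add: Q_space_def complex_vec.span_scale)
  have Q0: "0 \<in> ?Q" by (simp add: Q_space_def complex_vec.span_zero)
  have real: "\<omega> (v * v\<^sup>\<star>) \<in> \<real>" if "v \<in> ?V" for v
  proof -
    have "v * v\<^sup>\<star> \<in> Sigma2 \<gamma> n"
      unfolding Sigma2_def using that by (auto intro: hull_inc)
    then have "0 \<le> \<omega> (v * v\<^sup>\<star>)" using \<omega> by (auto simp: Sigma2_dual_def)
    then show ?thesis by (simp add: complex_is_Real_iff less_eq_complex_def)
  qed
  have gen: "\<omega> (w * v\<^sup>\<star>) = cnj (\<omega> (v * w\<^sup>\<star>))" if v: "v \<in> ?V" and w: "w \<in> ?V" for v w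
  proof -
    note Q = Sigma2_generator_in_Q[OF v v] Sigma2_generator_in_Q[OF v w]
      Sigma2_generator_in_Q[OF w v] Sigma2_generator_in_Q[OF w w]
    have expand: "\<omega> ((v + c *\<^sub>C w) * (v + c *\<^sub>C w)\<^sup>\<star>) =
        \<omega> (v * v\<^sup>\<star>) + (cnj c * \<omega> (v * w\<^sup>\<star>) + c * \<omega> (w * v\<^sup>\<star>)) + (c * cnj c) * \<omega> (w * w\<^sup>\<star>)" for c
      by (simp add: distrib_left distrib_right adj_add adj_scaleC mult_scaleC_left
          mult_scaleC_right scaleC_scaleC add scale Q Qadd Qscale algebra_simps)
    have "cnj c * \<omega> (v * w\<^sup>\<star>) + c * \<omega> (w * v\<^sup>\<star>) \<in> \<real>" for c
    proof -
      have "v + c *\<^sub>C w \<in> ?V"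
        using v w by (simp add: V_space_def complex_vec.span_add complex_vec.span_scale)
      from real[OF this] real[OF v] real[OF w] show ?thesis
        unfolding expand by (auto simp: complex_is_Real_iff)
    qed
    from this[of 1] this[of \<i>] show ?thesis
      by (intro real_if_polarized) auto
  qed
  have adj0: "(0::'a)\<^sup>\<star> = 0"
    using adj_scaleC[of 0 "0::'a"] by simp
  have \<omega>0: "\<omega> 0 = 0" using scale[OF Q0, of 0] by simp
  have "x \<in> ?Q \<and> x\<^sup>\<star> \<in> ?Q \<and> \<omega> (x\<^sup>\<star>) = cnj (\<omega> x)"
    using x unfolding Q_space_def[of \<gamma> n]
  proof (induction rule: complex_vec.span_induct_alt)
    case base
    show ?case using Q0 by (simp add: adj0 \<omega>0 Q_space_def)
  next
    case (step c x y)
    then obtain i j where ij: "i \<in> {1..n}" "j \<in> {1..n}" "x = \<gamma> i * (\<gamma> j)\<^sup>\<star>" by auto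
    then have V: "\<gamma> i \<in> ?V" "\<gamma> j \<in> ?V"
      by (auto simp: V_space_def intro: complex_vec.span_base)
    have xa: "x\<^sup>\<star> = \<gamma> j * (\<gamma> i)\<^sup>\<star>" by (simp add: ij adj_mult adj_adj)
    have x: "x \<in> ?Q" "x\<^sup>\<star> \<in> ?Q" "\<omega> (x\<^sup>\<star>) = cnj (\<omega> x)"
      using V gen[OF V] Sigma2_generator_in_Q[OF V] Sigma2_generator_in_Q[OF V(2,1)]
      unfolding xa by (simp_all add: ij)
    have y: "y \<in> ?Q" "y\<^sup>\<star> \<in> ?Q" "\<omega> (y\<^sup>\<star>) = cnj (\<omega> y)"
      using step.IH by (simp_all add: Q_space_def)
    show ?case
      unfolding Q_space_def[symmetric]
      by (simp add: adj_add adj_scaleC x y add scale Qadd Qscale)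
  qed
  then show ?thesis by simp
qed

lemma Sigma2_dual_real:
  assumes "\<omega> \<in> Sigma2_dual \<gamma> n" "x \<in> Q_space \<gamma> n" "selfadjoint x"
  shows "\<omega> x \<in> \<real>"
  using Sigma2_dual_adj[OF assms(1,2)] assms(3)
  by (simp add: selfadjoint_def Reals_cnj_iff)

end

theory Submission
  imports Defs
begin

text \<open>
  The second program is a relaxation of the first. A functional that is nonnegative on all squares
  \<open>x * x\<^sup>\<star>\<close> of the algebra is nonnegative on those with \<open>x\<close> in \<^term>\<open>V_space \<gamma> n\<close>, hence by
  linearity on their convex hull; its restriction to \<^term>\<open>Q_space \<gamma> n\<close> is therefore in
  \<^term>\<open>Sigma2_dual \<gamma> n\<close> (\<open>restrict_positive_dual_in_Sigma2_dual\<close>). Restricting further to the span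
  of the \<open>F i\<close> changes neither the constraints nor the objective, since both only evaluate the
  functional at the \<open>F i\<close>. So each value attained in the first program is also attained in the
  second, whose infimum is then the smaller one.
\<close>

lemma convex_Q_space: "convex (Q_space \<gamma> n)"
  unfolding convex_def scaleR_scaleC Q_space_def
  by (blast intro: complex_vec.span_add complex_vec.span_scale)

lemma Sigma2_subset_Q_space: "Sigma2 \<gamma> n \<subseteq> Q_space \<gamma> n"
  unfolding Sigma2_def
  by (rule hull_minimal) (auto intro: Sigma2_generator_in_Q convex_Q_space)

text \<open>
  Convexity refers to real scalars while \<open>\<omega>\<close> is complex-linear; real scalars act as complex ones
  by \<open>scaleR_scaleC\<close>, so \<open>\<omega>\<close> respects convex combinations.
\<close>

lemma convex_nonneg_linear:
  assumes "Vector_Spaces.linear scaleC (*) \<omega>"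
  shows "convex {x :: 'a::c_star_algebra. (0::complex) \<le> \<omega> x}"
proof -
  interpret Vector_Spaces.linear scaleC "(*)" \<omega> by (fact assms)
  have "0 \<le> complex_of_real r" if "0 \<le> r" for r
    using that by (simp add: less_eq_complex_def)
  then show ?thesis
    unfolding convex_def scaleR_scaleC
    by (auto simp: add scale intro!: add_nonneg_nonneg mult_nonneg_nonneg)
qed

lemma positive_dual_nonneg_on_Sigma2:
  assumes "\<omega> \<in> positive_dual" "s \<in> Sigma2 \<gamma> n"
  shows "0 \<le> \<omega> s"
proof -
  have "Sigma2 \<gamma> n \<subseteq> {x. 0 \<le> \<omega> x}"
    unfolding Sigma2_def
    using assms(1)
    by (intro hull_minimal convex_nonneg_linear) (auto simp: positive_dual_def positive_cone_def)
  then show ?thesis using assms(2) by auto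
qed

lemma restrict_linear_functional:
  assumes "Vector_Spaces.linear scaleC (*) \<omega>"
  shows "restrict \<omega> (cspan B) \<in> linear_functionals_on (cspan B)"
proof -
  interpret Vector_Spaces.linear scaleC "(*)" \<omega> by (fact assms)
  show ?thesis
    by (auto simp: linear_functionals_on_def add scale complex_vec.span_add complex_vec.span_scale)
qed

lemma restrict_positive_dual_in_Sigma2_dual:
  assumes "\<omega> \<in> positive_dual"
  shows "restrict \<omega> (Q_space \<gamma> n) \<in> Sigma2_dual \<gamma> n"
proof -
  have "restrict \<omega> (Q_space \<gamma> n) \<in> linear_functionals_on (Q_space \<gamma> n)"
    using assms unfolding Q_space_def
    by (intro restrict_linear_functional) (simp add: positive_dual_def)
  then show ?thesis
    using assms Sigma2_subset_Q_space[of \<gamma> n]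
    by (auto simp: Sigma2_dual_def positive_dual_nonneg_on_Sigma2)
qed

lemma restrict_positive_dual_in_restrictions:
  assumes "\<omega> \<in> positive_dual" "S \<subseteq> Q_space \<gamma> n"
  shows "restrict \<omega> S \<in> restrictions (Sigma2_dual \<gamma> n) S"
proof -
  have "restrict \<omega> S = restrict (restrict \<omega> (Q_space \<gamma> n)) S"
    using assms(2) by (simp add: restrict_restrict Int_absorb1)
  then show ?thesis
    unfolding restrictions_def
    using restrict_positive_dual_in_Sigma2_dual[OF assms(1)] by blast
qed

theorem proposition1:
  fixes F :: "nat \<Rightarrow> 'a::c_star_algebra" and f :: "nat \<Rightarrow> real" and m :: nat
    and \<gamma> :: "nat \<Rightarrow> 'a" and n :: nat
  assumes "\<And>i. i \<in> {0..m} \<Longrightarrow> selfadjoint (F i)"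
    and "cspan (F ` {0..m}) \<subseteq> Q_space \<gamma> n"
  shows
    "(INF \<omega> \<in> {\<omega> \<in> restrictions (Sigma2_dual \<gamma> n) (cspan (F ` {0..m})).
              \<forall>i\<in>{1..m}. \<omega> (F i) \<le> complex_of_real (f i)}. ereal (Re (\<omega> (F 0))))
     \<le> (INF \<omega> \<in> {\<omega> \<in> positive_dual. \<forall>i\<in>{1..m}. \<omega> (F i) \<le> complex_of_real (f i)}.
            ereal (Re (\<omega> (F 0))))"
proof (rule INF_mono)
  fix \<omega> :: "'a \<Rightarrow> complex"
  assume \<omega>: "\<omega> \<in> {\<omega> \<in> positive_dual. \<forall>i\<in>{1..m}. \<omega> (F i) \<le> complex_of_real (f i)}"
  let ?S = "cspan (F ` {0..m})"
  let ?\<omega> = "restrict \<omega> ?S"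
  have eval: "?\<omega> (F i) = \<omega> (F i)" if "i \<in> {0..m}" for i
    using that by (simp add: complex_vec.span_base)
  have "?\<omega> \<in> restrictions (Sigma2_dual \<gamma> n) ?S"
    using \<omega> assms(2) by (intro restrict_positive_dual_in_restrictions) auto
  moreover have "\<forall>i\<in>{1..m}. ?\<omega> (F i) \<le> complex_of_real (f i)"
    using \<omega> eval by auto
  moreover have "ereal (Re (?\<omega> (F 0))) \<le> ereal (Re (\<omega> (F 0)))"
    using eval[of 0] by simp
  ultimately show "\<exists>\<omega>'\<in>{\<omega> \<in> restrictions (Sigma2_dual \<gamma> n) ?S.
      \<forall>i\<in>{1..m}. \<omega> (F i) \<le> complex_of_real (f i)}.
      ereal (Re (\<omega>' (F 0))) \<le> ereal (Re (\<omega> (F 0)))"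
    by blast
qed

end
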